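(* There is a universal constant $C>0$ such that the following holds. Let $N\ge1$ be an integer, let $a_1<\cdots<a_N$ be any points in $[0,N]$, and let $E_{\{a_i\}}$ be the corresponding $N$-periodic vector field. Let $u_{p,i}=a_{i+p}-a_i$ with the convention $a_{N+l}=a_l+N$, and let $b_{p,i}=u_{p,i}-p$. Then $$W(E_{\{a_i\}})-W(\mathbb{Z})\ \ge\ C\sum_{p=1}^{N/2}\frac1N\sum_{i=1}^N\min\left(\frac{b_{p,i}^2}{p^2},\,1\right),$$ where the outer sum is over integers $1\le p\le N/2$.
   Context: The real line $\mathbb{R}$ is identified with $\mathbb{R}\times\{0\}\subset\mathbb{R}^2$; points of the plane are written $z=(x,y)$. $\delta_{\mathbb{R}}$ is the length measure on this line. $\mathcal{A}_1$ is the set of gradient vector fields $E$ on $\mathbb{R}^2$ with $\operatorname{div}E=2\pi(\nu-\delta_{\mathbb{R}})$ in $\mathbb{R}^2$, where $\nu=\sum_{x\in\Lambda}\delta_x$ for some discrete set $\Lambda\subset\mathbb{R}\subset\mathbb{R}^2$ and $\nu([-R,R])/R$ is bounded by a constant independent of $R>1$. Renormalized energy: for $E\in\mathcal{A}_1$ with point set $\Lambda$ and a bounded function $\chi$, $$W(E,\chi)=\lim_{\eta\to0}\Big(\tfrac12\int_{\mathbb{R}^2\setminus\cup_{p\in\Lambda}B(p,\eta)}\chi|E|^2+\pi\log\eta\sum_{p\in\Lambda}\chi(p)\Big),\qquad W(E)=\limsup_{R\to\infty}\frac{W(E,\chi_R)}{R},$$ where $\{\chi_R\}_{R>0}$ is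 a family of cut-off functions with $|\nabla\chi_R|\le C$ ($C$ independent of $R$), $\operatorname{Supp}(\chi_R)\subset[-R/2,R/2]\times\mathbb{R}$, and $\chi_R(z)=1$ if $|x|<R/2-1$. Periodic field: given $N$ points $a_1,\dots,a_N$ on the torus $\mathbb{R}/(N\mathbb{Z})$, let $\Lambda=\{a_i+kN: 1\le i\le N,\ k\in\mathbb{Z}\}$; $E_{\{a_i\}}$ is the unique $E\in\mathcal{A}_1$ with point set $\Lambda$ and $W(E)<+\infty$. It is known (and may be used as the definition of $W(E_{\{a_i\}})$) that $$W(E_{\{a_i\}})=-\frac{\pi}{N}\sum_{i\ne j}\log\left|2\sin\frac{\pi(a_i-a_j)}{N}\right|-\pi\log\frac{2\pi}{N},$$ read as $+\infty$ if two of the points coincide modulo $N$. $W(\mathbb{Z})$ is the energy of the periodic field associated to $\mathbb{Z}$ (the case $N=1$), equal to $-\pi\log(2\pi)$. *)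

theory Defs
  imports Complex_Main "HOL-Library.Extended_Real"
begin

text \<open>
  Renormalized energy of the \<open>N\<close>-periodic field generated by the points
  \<open>a 1, \<dots>, a N\<close> on the torus \<open>\<real>/N\<int>\<close>, given by its closed formula. The sum ranges over
  ordered pairs; the value is \<open>\<infinity>\<close> if two of the points coincide modulo \<open>N\<close>.
\<close>
definition W_periodic :: "nat \<Rightarrow> (nat \<Rightarrow> real) \<Rightarrow> ereal" where
  "W_periodic N a =
     (if \<exists>i\<in>{1..N}. \<exists>j\<in>{1..N}. i \<noteq> j \<and> (\<exists>k::int. a i - a j = of_int k * real N) then \<infinity>
      else ereal (- (pi / real N) *
                    (\<Sum>i = 1..N. \<Sum>j \<in> {1..N} - {i}.
                       ln \<bar>2 * sin (pi * (a i - a j) / real N)\<bar>)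
                  - pi * ln (2 * pi / real N)))"

text \<open>The point set \<open>\<int>\<close> is generated by the single point \<open>0\<close> with period \<open>1\<close>.\<close>
definition W_integers :: ereal where
  "W_integers = W_periodic 1 (\<lambda>_. 0)"

lemma W_integers_eq: "W_integers = ereal (- pi * ln (2 * pi))"
  by (simp add: W_integers_def W_periodic_def)

text \<open>
  The extension of \<open>a 1, \<dots>, a N\<close> to all indices \<open>k \<ge> 1\<close> by the convention
  \<open>a (N + l) = a l + N\<close>.
\<close>
definition periodic_ext :: "nat \<Rightarrow> (nat \<Rightarrow> real) \<Rightarrow> nat \<Rightarrow> real" where
  "periodic_ext N a k = a (Suc ((k - 1) mod N)) + real N * real ((k - 1) div N)"

lemma periodic_ext_base: "1 \<le> k \<Longrightarrow> k \<le> N \<Longrightarrow> periodic_ext N a k = a k"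
  by (simp add: periodic_ext_def)

lemma periodic_ext_add:
  assumes "1 \<le> N" "1 \<le> l"
  shows "periodic_ext N a (N + l) = periodic_ext N a l + real N"
proof -
  obtain m where "l = Suc m"
    using assms(2) by (cases l) auto
  then show ?thesis
    using assms(1) by (simp add: periodic_ext_def distrib_left)
qed

definition gap :: "nat \<Rightarrow> (nat \<Rightarrow> real) \<Rightarrow> nat \<Rightarrow> nat \<Rightarrow> real" where
  "gap N a p i = periodic_ext N a (i + p) - periodic_ext N a i"

definition gap_excess :: "nat \<Rightarrow> (nat \<Rightarrow> real) \<Rightarrow> nat \<Rightarrow> nat \<Rightarrow> real" where
  "gap_excess N a p i = gap N a p i - real p"

end

theory Submission
  imports Defs "HOL-Analysis.Complex_Transcendental" "HOL-Computational_Algebra.Polynomial"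
begin

text \<open>
  Grouping the pairs of points by index difference \<open>p\<close> and using
  \<open>\<Prod>\<^sub>p 2 sin (\<pi> p / N) = N\<close>, the difference of the energies is \<open>-\<pi>/N\<close> times the sum of
  \<open>ln (sin (\<pi> u\<^sub>p\<^sub>,\<^sub>i / N)) - ln (sin (\<pi> p / N))\<close>. For fixed \<open>p\<close> the \<open>u\<^sub>p\<^sub>,\<^sub>i\<close> have mean \<open>p\<close>, so the
  tangent line of \<open>ln \<circ> sin\<close> at \<open>\<pi> p / N\<close> does not contribute, and the concavity defect
  is at least that of \<open>ln\<close>, because \<open>ln t - ln (sin t)\<close> is convex on \<open>(0, \<pi>)\<close>.
\<close>

section \<open>Quantitative concavity of \<open>ln\<close> and of \<open>ln\<close> composed with
  \<open>sin\<close>\<close>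

text \<open>With \<open>r = sqrt x\<close>, the bound \<open>ln r \<le> r - 1\<close> doubles to
  \<open>ln x \<le> x - 1 - (r - 1)\<^sup>2\<close>, so the square root already produces a quadratic
  gain.\<close>

lemma ln_le_tangent_minus_min:
  fixes x :: real
  assumes "x > 0"
  shows "ln x \<le> x - 1 - min ((x - 1)\<^sup>2) 1 / 9"
proof -
  define r where "r = sqrt x"
  have r: "r > 0" "x = r\<^sup>2"
    using assms by (auto simp: r_def)
  \<comment> \<open>The constant 9 is \<open>(r + 1)\<^sup>2\<close> at the threshold
    \<open>r = 2\<close>; beyond it \<open>(r - 1)\<^sup>2\<close> exceeds 1 and the truncation
    takes over.\<close>
  have "min ((x - 1)\<^sup>2) 1 \<le> 9 * (r - 1)\<^sup>2"
  proof (cases "r \<le> 2")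
    case True
    have "(x - 1)\<^sup>2 = (r + 1)\<^sup>2 * (r - 1)\<^sup>2"
      unfolding r by algebra
    also have "\<dots> \<le> 3\<^sup>2 * (r - 1)\<^sup>2"
      using True r by (intro mult_right_mono power_mono) auto
    finally show ?thesis by simp
  next
    case False
    then have "1\<^sup>2 \<le> (r - 1)\<^sup>2"
      by (intro power_mono) auto
    then show ?thesis by simp
  qed
  moreover have "ln x = 2 * ln r"
    using r by (simp add: ln_realpow)
  moreover have "ln r \<le> r - 1"
    using r by (intro ln_le_minus_one)
  ultimately show ?thesis
    unfolding r by (simp add: power2_eq_square algebra_simps)
qed

text \<open>Write \<open>ln (sin t)\<close> as \<open>ln t\<close> minus the convex function
  \<open>ln t - ln (sin t)\<close>. The latter lies above its tangent at \<open>x\<close>, and the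
  former loses the defect of the previous lemma at the ratio \<open>y / x\<close>.\<close>

lemma ln_sin_le_tangent:
  fixes x y :: real
  assumes "x \<in> {0<..<pi}" "y \<in> {0<..<pi}"
  shows "ln (sin y) \<le> ln (sin x) + cot x * (y - x) - min ((y / x - 1)\<^sup>2) 1 / 9"
proof -
  have "(1 / x - cot x) * (y - x) \<le> (ln y - ln (sin y)) - (ln x - ln (sin x))"
  proof (rule f''_imp_f'[where C = "{0<..<pi}" and f'' = "\<lambda>t. 1 / (sin t)\<^sup>2 - 1 / t\<^sup>2"])
    fix t :: real assume t: "t \<in> {0<..<pi}"
    then have s: "sin t > 0" "t > 0"
      by (auto intro: sin_gt_zero)
    show "((\<lambda>t. ln t - ln (sin t)) has_real_derivative 1 / t - cot t) (at t)"
      using s by (auto intro!: derivative_eq_intros simp: cot_def field_simps)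
    show "((\<lambda>t. 1 / t - cot t) has_real_derivative 1 / (sin t)\<^sup>2 - 1 / t\<^sup>2) (at t)"
      using s by (auto intro!: derivative_eq_intros DERIV_cot[THEN DERIV_cong]
                       simp: field_simps power2_eq_square)
    have "(sin t)\<^sup>2 \<le> t\<^sup>2"
      using s by (intro power_mono sin_x_le_x) auto
    then show "0 \<le> 1 / (sin t)\<^sup>2 - 1 / t\<^sup>2"
      using s by (simp add: frac_le)
  qed (use assms in auto)
  moreover have "ln (y / x) \<le> y / x - 1 - min ((y / x - 1)\<^sup>2) 1 / 9"
    using assms by (intro ln_le_tangent_minus_min) auto
  moreover have "ln (y / x) = ln y - ln x"
    using assms by (simp add: ln_div)
  moreover have "(1 / x - cot x) * (y - x) = y / x - 1 - cot x * (y - x)"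
    using assms by (simp add: field_simps)
  ultimately show ?thesis by linarith
qed

section \<open>The sine product, which evaluates the energy of equally spaced points\<close>

text \<open>The roots of unity other than 1 are the roots of \<open>1 + X + ... + X^(n-1)\<close>;
  its factorization is evaluated at 1.\<close>

lemma prod_one_minus_roots_unity:
  assumes "n > 0"
  shows "(\<Prod>z\<in>{z::complex. z ^ n = 1} - {1}. 1 - z) = of_nat n"
proof -
  define A where "A = {z::complex. z ^ n = 1} - {1}"
  have fin: "finite A"
    using assms by (simp add: A_def finite_roots_unity)
  have card: "card A = n - 1"
    using assms by (simp add: A_def card_Diff_singleton card_roots_unity_eq)
  define P where "P = (\<Prod>z\<in>A. [:- z, 1:])"
  define Q :: "complex poly" where "Q = (\<Sum>j<n. monom 1 j)"
  have degP: "degree P = n - 1"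
    unfolding P_def by (subst degree_prod_eq_sum_degree) (auto simp: card)
  have "P = Q"
  \<comment> \<open>Both polynomials are monic of degree \<open>n - 1\<close>, so agreement at the
    \<open>n - 1\<close> points of \<open>A\<close> suffices.\<close>
  proof (rule poly_eqI_degree_lead_coeff[where n = "n - 1" and A = A])
    have "lead_coeff P = 1"
      unfolding P_def by (simp add: lead_coeff_prod)
    moreover have "coeff Q (n - 1) = 1"
      using assms by (simp add: Q_def coeff_sum)
    ultimately show "coeff P (n - 1) = coeff Q (n - 1)"
      using degP by simp
    show "degree Q \<le> n - 1"
      unfolding Q_def by (intro degree_sum_le) (auto intro: order.trans[OF degree_monom_le])
    fix z assume z: "z \<in> A"
    have "poly P z = 0"
      unfolding P_def poly_prod using z fin by (intro prod_zero) auto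
    moreover have "poly Q z = 0"
      using z geometric_sum[of z n] by (auto simp: Q_def A_def poly_sum poly_monom)
    ultimately show "poly P z = poly Q z" by simp
  qed (simp_all add: card degP)
  then have "poly P 1 = poly Q 1" by simp
  then show ?thesis
    by (simp add: P_def Q_def A_def poly_prod poly_sum poly_monom)
qed

text \<open>Each factor is the length of the chord from 1 to an \<open>n\<close>-th root of
  unity.\<close>

lemma prod_two_sin:
  assumes "n > 0"
  shows "(\<Prod>k=1..<n. 2 * sin (pi * real k / real n)) = real n"
proof -
  let ?f = "\<lambda>k. cis (2 * pi * real k / real n)"
  have "bij_betw ?f ({..<n} - {0}) ({z. z ^ n = 1} - {?f 0})"
    using assms Complex.bij_betw_roots_unity[OF assms] by (intro bij_betw_DiffI) auto
  moreover have "{..<n} - {0} = {1..<n}"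
    by auto
  ultimately have bij: "bij_betw ?f {1..<n} ({z. z ^ n = 1} - {1})"
    by simp
  have "2 * sin (pi * real k / real n) = norm (1 - ?f k)" if "k \<in> {1..<n}" for k
  proof -
    have "sin (pi * real k / real n) > 0"
      using that by (intro sin_gt_zero) (auto simp: field_simps)
    then show ?thesis
      using dist_exp_i_1[of "2 * pi * real k / real n"]
      by (simp add: norm_minus_commute cis_conv_exp)
  qed
  then have "(\<Prod>k=1..<n. 2 * sin (pi * real k / real n)) = norm (\<Prod>k=1..<n. 1 - ?f k)"
    by (simp add: prod_norm)
  also have "(\<Prod>k=1..<n. 1 - ?f k) = of_nat n"
    using prod.reindex_bij_betw[OF bij, of "\<lambda>z. 1 - z"] prod_one_minus_roots_unity[OF assms] by simp
  finally show ?thesis by simp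
qed

lemma sum_ln_two_sin:
  assumes "n > 0"
  shows "(\<Sum>k=1..<n. ln (2 * sin (pi * real k / real n))) = ln (real n)"
proof -
  have "sin (pi * real k / real n) > 0" if "k \<in> {1..<n}" for k
    using that by (intro sin_gt_zero) (auto simp: field_simps)
  then have "ln (\<Prod>k=1..<n. 2 * sin (pi * real k / real n))
      = (\<Sum>k=1..<n. ln (2 * sin (pi * real k / real n)))"
    by (intro ln_prod) force+
  then show ?thesis
    using prod_two_sin[OF assms] by simp
qed

section \<open>Gaps of the periodic configuration\<close>

lemma periodic_ext_gt:
  assumes "N < k" "k \<le> 2 * N"
  shows "periodic_ext N a k = a (k - N) + real N"
  using periodic_ext_add[of N "k - N" a] periodic_ext_base[of "k - N" N a] assms by simp

text \<open>Raising \<open>p\<close> by one telescopes: a term is replaced by the one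
  \<open>N\<close> indices later, which is larger by \<open>N\<close>.\<close>

lemma sum_periodic_ext_shift:
  assumes "1 \<le> N"
  shows "(\<Sum>i=1..N. periodic_ext N a (i + p)) = (\<Sum>i=1..N. periodic_ext N a i) + real p * real N"
proof (induction p)
  case (Suc p)
  have "(\<Sum>i=1..N. periodic_ext N a (i + Suc p)) - (\<Sum>i=1..N. periodic_ext N a (i + p))
      = (\<Sum>i=1..N. periodic_ext N a (Suc i + p) - periodic_ext N a (i + p))"
    by (simp add: sum_subtractf)
  also have "\<dots> = periodic_ext N a (N + (1 + p)) - periodic_ext N a (1 + p)"
    using assms by (subst sum_Suc_diff) auto
  also have "\<dots> = real N"
    using assms by (subst periodic_ext_add) auto
  finally show ?case
    using Suc by (simp add: algebra_simps)
qed simp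

lemma sum_gap_excess:
  assumes "1 \<le> N"
  shows "(\<Sum>i=1..N. gap_excess N a p i) = 0"
  using sum_periodic_ext_shift[OF assms, of a p]
  by (simp add: gap_excess_def gap_def sum_subtractf)

text \<open>For fixed \<open>i\<close>, the residue of \<open>j - i\<close> modulo \<open>N\<close>
  runs once through \<open>1..<N\<close>. Evenness and periodicity make \<open>F\<close> insensitive
  to the order of the pair and to wrapping around the torus.\<close>

lemma sum_pairs_eq_sum_gaps:
  fixes F :: "real \<Rightarrow> real"
  assumes even: "\<And>x. F (- x) = F x" and per: "\<And>x. F (x + real N) = F x"
  shows "(\<Sum>i=1..N. \<Sum>j\<in>{1..N} - {i}. F (a i - a j)) = (\<Sum>p=1..<N. \<Sum>i=1..N. F (gap N a p i))"
proof -
  have "(\<Sum>j\<in>{1..N} - {i}. F (a i - a j)) = (\<Sum>p=1..<N. F (gap N a p i))" if i: "i \<in> {1..N}" for i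
  proof (rule sum.reindex_bij_witness[where
      i = "\<lambda>p. if i + p \<le> N then i + p else i + p - N" and
      j = "\<lambda>j. if i < j then j - i else j + N - i"])
    fix j assume j: "j \<in> {1..N} - {i}"
    show "F (gap N a (if i < j then j - i else j + N - i) i) = F (a i - a j)"
    proof (cases "i < j")
      case True
      then show ?thesis
        using i j even[of "a i - a j"] by (simp add: gap_def periodic_ext_base)
    next
      case False
      then have "gap N a (j + N - i) i = - (a i - a j) + real N"
        using i j by (simp add: gap_def periodic_ext_base periodic_ext_gt)
      then show ?thesis
        using False per[of "- (a i - a j)"] even[of "a i - a j"] by simp
    qed
  qed (use i in \<open>auto split: if_splits\<close>)
  then show ?thesis
    by (subst sum.swap) (rule sum.cong[OF refl])
qed

text \<open>This places \<open>pi * gap / N\<close> in the open interval where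
  \<open>ln (sin t)\<close> is concave.\<close>

lemma gap_bounds:
  assumes mono: "strict_mono_on {1..N} a" and range: "a ` {1..N} \<subseteq> {0..real N}"
    and distinct: "\<And>i j k. i \<in> {1..N} \<Longrightarrow> j \<in> {1..N} \<Longrightarrow> i \<noteq> j \<Longrightarrow> a i - a j \<noteq> of_int k * real N"
    and p: "p \<in> {1..<N}" and i: "i \<in> {1..N}"
  shows "gap N a p i \<in> {0<..<real N}"
proof (cases "i + p \<le> N")
  case True
  then have "gap N a p i = a (i + p) - a i"
    using i by (simp add: gap_def periodic_ext_base)
  moreover have "a i < a (i + p)"
    using True p i by (intro strict_mono_onD[OF mono]) auto
  moreover have "a i \<ge> 0" "a (i + p) \<le> real N"
    using True i range by (auto simp: image_subset_iff)
  \<comment> \<open>A gap of exactly \<open>N\<close> would require the endpoints 0 and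
    \<open>N\<close>, which are the same point of the torus.\<close>
  moreover have "a (i + p) - a i \<noteq> of_int 1 * real N"
    using True p i by (intro distinct) auto
  ultimately show ?thesis by auto
next
  case False
  define j where "j = i + p - N"
  have j: "j \<in> {1..N}" "j < i"
    using False p i by (auto simp: j_def)
  have "gap N a p i = a j + real N - a i"
    using False p i by (simp add: gap_def periodic_ext_base periodic_ext_gt j_def)
  moreover have "a j < a i"
    using j i by (intro strict_mono_onD[OF mono]) auto
  moreover have "a j \<ge> 0" "a i \<le> real N"
    using j i range by (auto simp: image_subset_iff)
  \<comment> \<open>After wrapping, the same coincidence is what a zero gap would mean.\<close>
  moreover have "a i - a j \<noteq> of_int 1 * real N"
    using j i by (intro distinct) auto
  ultimately show ?thesis by auto
qed

section \<open>The estimate for one index difference and its summation\<close>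

text \<open>The tangent estimate is taken at \<open>pi * p / N\<close> for every \<open>i\<close>;
  its linear term is a multiple of \<open>gap_excess\<close> and sums to zero.\<close>

lemma sum_ln_sin_gap_le:
  assumes p: "p \<in> {1..<N}" and gap: "\<And>i. i \<in> {1..N} \<Longrightarrow> gap N a p i \<in> {0<..<real N}"
  shows "(\<Sum>i=1..N. ln \<bar>2 * sin (pi * gap N a p i / real N)\<bar>)
    \<le> real N * ln (2 * sin (pi * real p / real N))
      - (\<Sum>i=1..N. min ((gap_excess N a p i)\<^sup>2 / (real p)\<^sup>2) 1) / 9"
proof -
  define x where "x = pi * real p / real N"
  have x: "x \<in> {0<..<pi}"
    using p by (auto simp: x_def field_simps)
  then have sinx: "sin x > 0"
    by (auto intro: sin_gt_zero)
  have "ln \<bar>2 * sin (pi * gap N a p i / real N)\<bar>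
      \<le> ln (2 * sin x) + cot x * pi / real N * gap_excess N a p i
        - min ((gap_excess N a p i)\<^sup>2 / (real p)\<^sup>2) 1 / 9" if i: "i \<in> {1..N}" for i
  proof -
    define y where "y = pi * gap N a p i / real N"
    have y: "y \<in> {0<..<pi}"
      using gap[OF i] by (auto simp: y_def field_simps)
    then have "sin y > 0"
      by (auto intro: sin_gt_zero)
    then have "ln \<bar>2 * sin y\<bar> - ln (2 * sin x) = ln (sin y) - ln (sin x)"
      using sinx by (simp add: ln_mult)
    moreover have "cot x * (y - x) = cot x * pi / real N * gap_excess N a p i"
      using p by (simp add: x_def y_def gap_excess_def field_simps)
    moreover have "y / x - 1 = gap_excess N a p i / real p"
      using p by (simp add: x_def y_def gap_excess_def field_simps)
    ultimately show ?thesis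
      using ln_sin_le_tangent[OF x y] by (simp add: power_divide flip: y_def)
  qed
  then have "(\<Sum>i=1..N. ln \<bar>2 * sin (pi * gap N a p i / real N)\<bar>)
      \<le> (\<Sum>i=1..N. ln (2 * sin x) + cot x * pi / real N * gap_excess N a p i
        - min ((gap_excess N a p i)\<^sup>2 / (real p)\<^sup>2) 1 / 9)"
    by (intro sum_mono)
  also have "\<dots> = real N * ln (2 * sin x)
      + cot x * pi / real N * (\<Sum>i=1..N. gap_excess N a p i)
      - (\<Sum>i=1..N. min ((gap_excess N a p i)\<^sup>2 / (real p)\<^sup>2) 1) / 9"
    by (simp add: sum.distrib sum_subtractf sum_distrib_left sum_divide_distrib)
  also have "(\<Sum>i=1..N. gap_excess N a p i) = 0"
    using p by (intro sum_gap_excess) auto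
  finally show ?thesis
    by (simp add: x_def)
qed

theorem lemma1p9:
  "\<exists>C::real. C > 0 \<and>
     (\<forall>(N::nat) (a :: nat \<Rightarrow> real).
        1 \<le> N \<longrightarrow> strict_mono_on {1..N} a \<longrightarrow> a ` {1..N} \<subseteq> {0..real N} \<longrightarrow>
        W_periodic N a - W_integers \<ge>
          ereal (C * (\<Sum>p \<in> {p::nat. 1 \<le> p \<and> real p \<le> real N / 2}.
                   1 / real N * (\<Sum>i = 1..N. min ((gap_excess N a p i)\<^sup>2 / (real p)\<^sup>2) 1))))"
\<comment> \<open>The factor \<open>pi\<close> comes from the energy formula, the 9 from the defect
  of \<open>ln\<close>.\<close>
proof (intro exI[of _ "pi / 9"] conjI allI impI)
  fix N :: nat and a :: "nat \<Rightarrow> real"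
  assume N: "1 \<le> N" and mono: "strict_mono_on {1..N} a" and range: "a ` {1..N} \<subseteq> {0..real N}"
  define M where "M p = (\<Sum>i = 1..N. min ((gap_excess N a p i)\<^sup>2 / (real p)\<^sup>2) 1)" for p
  have "ereal (pi / 9 * (\<Sum>p | 1 \<le> p \<and> real p \<le> real N / 2. 1 / real N * M p))
      \<le> W_periodic N a - W_integers"
  proof (cases "\<exists>i\<in>{1..N}. \<exists>j\<in>{1..N}. i \<noteq> j \<and> (\<exists>k::int. a i - a j = of_int k * real N)")
    case True
    then show ?thesis
      by (simp add: W_periodic_def W_integers_eq)
  next
    case False
    define F where "F x = ln \<bar>2 * sin (pi * x / real N)\<bar>" for x
    \<comment> \<open>The shift by \<open>N\<close> flips the sign of the sine; the absolute value
      absorbs it.\<close>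
    have "F (x + real N) = F x" "F (- x) = F x" for x
      using N by (simp_all add: F_def distrib_left add_divide_distrib)
    then have "(\<Sum>i=1..N. \<Sum>j\<in>{1..N} - {i}. F (a i - a j))
        = (\<Sum>p=1..<N. \<Sum>i=1..N. F (gap N a p i))"
      by (intro sum_pairs_eq_sum_gaps)
    also have "\<dots> \<le> (\<Sum>p=1..<N. real N * ln (2 * sin (pi * real p / real N)) - M p / 9)"
      unfolding F_def M_def using False
      by (intro sum_mono sum_ln_sin_gap_le gap_bounds mono range) blast+
    also have "\<dots> = real N * ln (real N) - (\<Sum>p=1..<N. M p) / 9"
      using N sum_ln_two_sin[of N]
      by (simp add: sum_subtractf flip: sum_distrib_left sum_divide_distrib)
    also have "\<dots> \<le> real N * ln (real N) - (\<Sum>p | 1 \<le> p \<and> real p \<le> real N / 2. M p) / 9"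
    proof -
      \<comment> \<open>Since \<open>N \<ge> 1\<close>, \<open>p \<le> N / 2\<close> forces
        \<open>p < N\<close>; the discarded terms are nonnegative.\<close>
      have "(\<Sum>p | 1 \<le> p \<and> real p \<le> real N / 2. M p) \<le> (\<Sum>p=1..<N. M p)"
        by (intro sum_mono2) (auto simp: M_def intro!: sum_nonneg)
      then show ?thesis by simp
    qed
    finally have "pi / real N * (\<Sum>i=1..N. \<Sum>j\<in>{1..N} - {i}. F (a i - a j))
        \<le> pi / real N * (real N * ln (real N) - (\<Sum>p | 1 \<le> p \<and> real p \<le> real N / 2. M p) / 9)"
      by (intro mult_left_mono) auto
    also have "\<dots> = pi * ln (real N)
        - pi / 9 * (\<Sum>p | 1 \<le> p \<and> real p \<le> real N / 2. 1 / real N * M p)"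
      using N by (simp add: field_simps flip: sum_divide_distrib)
    finally have "pi / 9 * (\<Sum>p | 1 \<le> p \<and> real p \<le> real N / 2. 1 / real N * M p)
        \<le> - (pi / real N) * (\<Sum>i=1..N. \<Sum>j\<in>{1..N} - {i}. F (a i - a j)) + pi * ln (real N)"
      by simp
    \<comment> \<open>The term \<open>pi * ln N\<close> is exactly the difference between the
      additive constants of the two energies.\<close>
    also have "\<dots> = - (pi / real N) * (\<Sum>i=1..N. \<Sum>j\<in>{1..N} - {i}. F (a i - a j))
        - pi * ln (2 * pi / real N) - (- pi * ln (2 * pi))"
      using N by (simp add: ln_div algebra_simps)
    finally show ?thesis
      using False unfolding W_periodic_def W_integers_eq F_def by simp
  qed
  then show "W_periodic N a - W_integers \<ge>
      ereal (pi / 9 * (\<Sum>p \<in> {p::nat. 1 \<le> p \<and> real p \<le> real N / 2}.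
        1 / real N * (\<Sum>i = 1..N. min ((gap_excess N a p i)\<^sup>2 / (real p)\<^sup>2) 1)))"
    unfolding M_def .
qed simp

end
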